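(* For every real $r>0$, \[ \limsup_{l\to\infty}\mathrm{Succ}\bigl(\lceil r\log(e)\,l\rceil,\,l\bigr)\le\frac{\log(r+1)}{r\log e}, \] where $e$ is the base of the natural logarithm. Consequently, if $h\to\infty$ and $l=l(h)\ge1$ is an integer-valued function with $l(h)=o(h)$, then $\mathrm{Succ}(h,l(h))\to0$.
   Context: All logarithms are base $2$. Collaborating cryptogenography protocol: there are $n$ players $\mathrm{plr}_1,\dots,\mathrm{plr}_n$; a secret $X$ (finitely supported) and indicators $L_1,\dots,L_n\in\{0,1\}$ ($L_i=1$ means $\mathrm{plr}_i$ knows $X$) have a joint distribution. A protocol $\pi$ specifies, for every possible partial transcript $t^k=(t_1,\dots,t_k)$ (the tuple of the first $k$ messages): whether communication stops; if not, which player $\mathrm{plr}_i$ sends the next message; and probability distributions $p_?$ and $(p_x)_{x}$ on a finite message set (depending on $t^k$). $\mathrm{plr}_i$ draws the next message, with fresh independent randomness, from $p_?$ if $L_i=0$ and from $p_x$ if $L_i=1$ and $X=x$. There is a number $\mathrm{length}(\pi)$ such that the protocol always stops after at most that many messages. $T$ denotes the random full transcript. The game $\mathrm{Succ}$: for real $h\ge0$ and integers $1\le l<n$, let $X$ be uniform on $\{1,\dots,2^{\lceil h\rceil}\}$ and, independently, let $(L_1,\dots,L_n)$ be uniform over the $0/1$-vectors with exactly $l$ ones. The players run a collaborating cryptogenography protocol $\pi$ with transcript $T$. Then Frank outputs a guess $F=f(T)$ of $X$, and Eve, seeing $T$ and $F$, outputs a player index $E=g(T,F)$. The players (and Frank)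 win if $F=X$ and $L_E=0$; otherwise Eve wins. $\mathrm{Succ}(h,l,n,\pi)=\max_f\min_g\Pr(F=X\text{ and }L_E=0)$. $\mathrm{Succ}(h,l,n)=\sup_\pi\mathrm{Succ}(h,l,n,\pi)$ and $\mathrm{Succ}(h,l)=\lim_{n\to\infty}\mathrm{Succ}(h,l,n)$ (this limit exists). *)

theory Defs
  imports "HOL-Probability.Probability" "HOL-Library.Landau_Symbols"
begin

text \<open>Collaborating cryptogenography protocols.
  Players are indexed 0..n-1, messages are natural numbers, transcripts are lists of messages.
  A protocol maps a partial transcript to None (stop) or Some (i, p_?, p) where i is the
  next speaker, p_? the message distribution if the speaker does not know X, and p x the
  message distribution if the speaker knows X = x.\<close>

type_synonym protocol = "nat list \<Rightarrow> (nat \<times> nat pmf \<times> (nat \<Rightarrow> nat pmf)) option"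

definition valid_protocol :: "nat \<Rightarrow> protocol \<Rightarrow> bool" where
  "valid_protocol n \<pi> \<longleftrightarrow>
     (\<exists>len. \<forall>t. len \<le> length t \<longrightarrow> \<pi> t = None) \<and>
     (\<forall>t i p0 p. \<pi> t = Some (i, p0, p) \<longrightarrow>
        i < n \<and> finite (set_pmf p0) \<and> (\<forall>x. finite (set_pmf (p x))))"

definition protocol_length :: "protocol \<Rightarrow> nat" where
  "protocol_length \<pi> = (LEAST len. \<forall>t. len \<le> length t \<longrightarrow> \<pi> t = None)"

primrec run :: "protocol \<Rightarrow> nat \<Rightarrow> nat set \<Rightarrow> nat \<Rightarrow> nat list \<Rightarrow> nat list pmf" where
  "run \<pi> x S 0 t = return_pmf t"
| "run \<pi> x S (Suc k) t =
     (case \<pi> t of None \<Rightarrow> return_pmf t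
      | Some (i, p0, p) \<Rightarrow>
          bind_pmf (if i \<in> S then p x else p0) (\<lambda>m. run \<pi> x S k (t @ [m])))"

definition game :: "real \<Rightarrow> nat \<Rightarrow> nat \<Rightarrow> protocol \<Rightarrow> (nat \<times> nat set \<times> nat list) pmf" where
  "game h l n \<pi> =
     bind_pmf (pmf_of_set {1..2 ^ nat \<lceil>h\<rceil>}) (\<lambda>x.
     bind_pmf (pmf_of_set {S. S \<subseteq> {0..<n} \<and> card S = l}) (\<lambda>S.
     map_pmf (\<lambda>t. (x, S, t)) (run \<pi> x S (protocol_length \<pi>) [])))"

definition win_prob ::
  "real \<Rightarrow> nat \<Rightarrow> nat \<Rightarrow> protocol \<Rightarrow> (nat list \<Rightarrow> nat) \<Rightarrow> (nat list \<Rightarrow> nat \<Rightarrow> nat) \<Rightarrow> real" where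
  "win_prob h l n \<pi> f g =
     measure_pmf.prob (game h l n \<pi>) {(x, S, t). f t = x \<and> g t (f t) \<notin> S}"

definition Succ_prot :: "real \<Rightarrow> nat \<Rightarrow> nat \<Rightarrow> protocol \<Rightarrow> real" where
  "Succ_prot h l n \<pi> =
     (SUP f. INF g \<in> {g :: nat list \<Rightarrow> nat \<Rightarrow> nat. \<forall>t y. g t y < n}. win_prob h l n \<pi> f g)"

definition Succ_n :: "real \<Rightarrow> nat \<Rightarrow> nat \<Rightarrow> real" where
  "Succ_n h l n = (SUP \<pi> \<in> {\<pi>. valid_protocol n \<pi>}. Succ_prot h l n \<pi>)"

definition Succ :: "real \<Rightarrow> nat \<Rightarrow> real" where
  "Succ h l = lim (\<lambda>n. Succ_n h l n)"

end

theory Submission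
  imports Defs "HOL-Real_Asymp.Real_Asymp"
begin

text \<open>For a fixed transcript \<open>t\<close> and secret \<open>x\<close>, the probability of \<open>t\<close> given the leaker set \<open>S\<close> is
  \<open>A(t) \<Prod>\<^bsub>i\<in>S\<^esub> \<rho>\<^sub>i\<close>, where \<open>A(t)\<close>, the probability of \<open>t\<close> without leakers, does not depend on \<open>x\<close>. Compare
  the game with \<open>l\<close> leakers to the same protocol run with \<open>l + 1\<close> leakers: with Eve's best guess, the winning
  weight of \<open>t\<close> times \<open>(1/n) \<Sum>\<rho>\<^sub>i\<close> is at most the probability of \<open>t\<close> with \<open>l + 1\<close> leakers. Transcripts with
  \<open>(1/n) \<Sum>\<rho>\<^sub>i > \<tau>\<close> thus contribute at most \<open>1/\<tau>\<close>, and on the others the likelihood ratio to \<open>A\<close> is about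
  \<open>\<tau>\<^sup>l\<close> at most, so that guessing one of \<open>2\<^sup>h\<close> secrets succeeds with probability at most about \<open>\<tau>\<^sup>l / 2\<^sup>h\<close>.
  Hence \<open>Succ h l \<le> \<tau>\<^sup>l / 2\<^sup>h + 1/\<tau>\<close> for every \<open>\<tau> > 0\<close>; take \<open>\<tau> = 1 + r\<close> for the first claim and \<open>\<tau>\<close> constant
  for the second. The limit defining \<open>Succ\<close> exists because the value is nondecreasing in the number of players:
  \<open>n + 1\<close> players can first let a non-leaker reveal himself almost for free.\<close>

subsection \<open>Transcript distributions\<close>

lemma prob_bind_pmf:
  "measure_pmf.prob (bind_pmf M f) A = (\<integral>x. measure_pmf.prob (f x) A \<partial>measure_pmf M)"
  by (auto simp: measure_pmf_bind measure_pmf.measure_bind[where N="count_space UNIV"] measure_subprob)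

lemma prob_bind_bernoulli:
  assumes "0 \<le> p" "p \<le> 1"
  shows "measure_pmf.prob (bind_pmf (bernoulli_pmf p) f) A =
    p * measure_pmf.prob (f True) A + (1 - p) * measure_pmf.prob (f False) A"
  using assms by (simp add: prob_bind_pmf)

text \<open>\<open>run\<close> appends messages at the end; peeling off the first one instead leaves
  a run of the shifted protocol from the empty transcript, the form that inductions over a fixed
  transcript need.\<close>

lemma run_Cons: "run \<pi> x S k (m # t) = map_pmf ((#) m) (run (\<lambda>u. \<pi> (m # u)) x S k t)"
  by (induction k arbitrary: t) (auto simp: map_bind_pmf split: option.split)

lemma run_length_bound:
  assumes "\<And>t. len \<le> length t \<Longrightarrow> \<pi> t = None" "len \<le> length t + k" "k \<le> k'"
  shows "run \<pi> x S k' t = run \<pi> x S k t"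
  using assms(2,3)
proof (induction k arbitrary: t k')
  case 0
  then show ?case using assms(1)[of t] by (cases k') auto
next
  case (Suc k)
  then obtain j where j: "k' = Suc j" "k \<le> j" by (cases k') auto
  have "run \<pi> x S j (t @ [m]) = run \<pi> x S k (t @ [m])" for m
    using Suc.IH[of "t @ [m]" j] Suc.prems j by simp
  then show ?case using j by (simp split: option.split)
qed

abbreviation transcript :: "protocol \<Rightarrow> nat \<Rightarrow> nat set \<Rightarrow> nat list pmf" where
  "transcript \<pi> x S \<equiv> run \<pi> x S (protocol_length \<pi>) []"

text \<open>Replaces the least bound in \<open>protocol_length\<close> by any convenient one: once
  the protocol has stopped, further rounds change nothing.\<close>

lemma transcript_eq_run:
  assumes "\<And>t. len \<le> length t \<Longrightarrow> \<pi> t = None" "len \<le> k"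
  shows "transcript \<pi> x S = run \<pi> x S k []"
proof -
  let ?stop = "\<lambda>len. \<forall>t. len \<le> length t \<longrightarrow> \<pi> t = None"
  have len: "?stop len" using assms(1) by blast
  have "?stop (protocol_length \<pi>)"
    unfolding protocol_length_def by (rule LeastI[of ?stop, OF len])
  moreover have "protocol_length \<pi> \<le> len"
    unfolding protocol_length_def by (rule Least_le[of ?stop, OF len])
  ultimately show ?thesis
    using assms(2) run_length_bound[of "protocol_length \<pi>" \<pi> "[]" "protocol_length \<pi>" k x S]
    by simp
qed

lemma finite_set_run:
  assumes "valid_protocol n \<pi>"
  shows "finite (set_pmf (run \<pi> x S k t))"
proof (induction k arbitrary: t)
  case (Suc k)
  have "\<And>i p0 p. \<pi> t = Some (i, p0, p) \<Longrightarrow> finite (set_pmf p0) \<and> finite (set_pmf (p x))"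
    using assms by (auto simp: valid_protocol_def)
  then show ?case using Suc by (auto split: option.split)
qed simp

text \<open>Without leakers the secret is never consulted. This makes the reference probability
  \<open>A(t)\<close> the same for all secrets.\<close>

lemma run_no_leaker: "run \<pi> x {} k t = run \<pi> y {} k t"
  by (induction k arbitrary: t) (simp_all split: option.split)

lemma pmf_bind_Cons:
  "pmf (bind_pmf p (\<lambda>m. map_pmf ((#) m) (f m))) (m # t) = pmf p m * pmf (f m) t"
proof -
  have *: "pmf (map_pmf ((#) a) (f a)) (m # t) = indicator {m} a * pmf (f m) t" for a
  proof (cases "a = m")
    case True
    then show ?thesis using pmf_map_inj'[of "(#) m" "f m" t] by (simp add: inj_def)
  next
    case False
    then have "m # t \<notin> set_pmf (map_pmf ((#) a) (f a))" by auto
    then show ?thesis using False by (simp add: pmf_eq_0_set_pmf)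
  qed
  show ?thesis by (simp add: pmf_bind * measure_pmf_single)
qed

text \<open>Each message contributes a factor depending on \<open>S\<close> only through whether its
  sender is in \<open>S\<close>. Collecting these by sender gives \<open>a i\<close> and
  \<open>b i\<close>; \<open>c\<close> is 0 or 1 and records whether the protocol stops exactly at
  \<open>t\<close>.\<close>

lemma pmf_run_product:
  assumes "\<And>t i p0 p. \<pi> t = Some (i, p0, p) \<Longrightarrow> i < n"
  shows "\<exists>c a b. 0 \<le> c \<and> (\<forall>i. 0 \<le> a i) \<and> (\<forall>i. 0 \<le> b i) \<and>
    (\<forall>S\<subseteq>{0..<n}. pmf (run \<pi> x S k []) t = (c::real) * (\<Prod>i\<in>{0..<n}. if i \<in> S then b i else a i))"
  using assms
proof (induction k arbitrary: \<pi> t)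
  case 0
  show ?case
    by (rule exI[of _ "if t = [] then 1 else 0"], rule exI[of _ "\<lambda>_. 1"], rule exI[of _ "\<lambda>_. 1"])
      (auto simp: pmf_return indicator_def)
next
  case (Suc k)
  show ?case
  proof (cases "\<pi> []")
    case None
    show ?thesis
      by (rule exI[of _ "if t = [] then 1 else 0"], rule exI[of _ "\<lambda>_. 1"], rule exI[of _ "\<lambda>_. 1"])
        (auto simp: None pmf_return indicator_def)
  next
    case (Some q)
    then obtain j p0 p where q: "\<pi> [] = Some (j, p0, p)" by (cases q) auto
    then have j: "j < n" using Suc.prems by blast
    have run: "run \<pi> x S (Suc k) [] = bind_pmf (if j \<in> S then p x else p0)
        (\<lambda>m. map_pmf ((#) m) (run (\<lambda>u. \<pi> (m # u)) x S k []))" for S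
      by (simp add: q run_Cons)
    show ?thesis
    proof (cases t)
      case Nil
      \<comment> \<open>The protocol speaks, so the empty transcript is impossible and
        \<open>c = 0\<close> will do.\<close>
      have "pmf (run \<pi> x S (Suc k) []) t = 0" for S
        unfolding run Nil pmf_eq_0_set_pmf by auto
      then show ?thesis
        by (intro exI[of _ 0] exI[of _ "\<lambda>_. 1"]) auto
    next
      case (Cons m u)
      have "\<exists>c a b. 0 \<le> c \<and> (\<forall>i. 0 \<le> a i) \<and> (\<forall>i. 0 \<le> b i) \<and>
          (\<forall>S\<subseteq>{0..<n}. pmf (run (\<lambda>u. \<pi> (m # u)) x S k []) u =
            (c::real) * (\<Prod>i\<in>{0..<n}. if i \<in> S then b i else a i))"
        by (rule Suc.IH) (rule Suc.prems)
      then obtain c :: real and a b :: "nat \<Rightarrow> real" where ab: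
        "0 \<le> c" "\<forall>i. 0 \<le> a i" "\<forall>i. 0 \<le> b i"
        "\<And>S. S \<subseteq> {0..<n} \<Longrightarrow> pmf (run (\<lambda>u. \<pi> (m # u)) x S k []) u =
          c * (\<Prod>i\<in>{0..<n}. if i \<in> S then b i else a i)"
        by blast
      \<comment> \<open>Only the factors of the first speaker \<open>j\<close> change: they pick up
        the probability of \<open>m\<close> in either role.\<close>
      define a' where "a' = a(j := a j * pmf p0 m)"
      define b' where "b' = b(j := b j * pmf (p x) m)"
      have "pmf (run \<pi> x S (Suc k) []) t = c * (\<Prod>i\<in>{0..<n}. if i \<in> S then b' i else a' i)"
        if "S \<subseteq> {0..<n}" for S
      proof -
        have "(\<Prod>i\<in>{0..<n}. if i \<in> S then b' i else a' i) =
          (if j \<in> S then b' j else a' j) * (\<Prod>i\<in>{0..<n}-{j}. if i \<in> S then b' i else a' i)"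
          using j by (subst prod.remove[of _ j]) auto
        also have "(\<Prod>i\<in>{0..<n}-{j}. if i \<in> S then b' i else a' i) =
            (\<Prod>i\<in>{0..<n}-{j}. if i \<in> S then b i else a i)"
          by (intro prod.cong) (auto simp: a'_def b'_def)
        also have "(if j \<in> S then b' j else a' j) * \<dots> = pmf (if j \<in> S then p x else p0) m *
            ((if j \<in> S then b j else a j) * (\<Prod>i\<in>{0..<n}-{j}. if i \<in> S then b i else a i))"
          by (auto simp: a'_def b'_def)
        also have "(if j \<in> S then b j else a j) * (\<Prod>i\<in>{0..<n}-{j}. if i \<in> S then b i else a i) =
            (\<Prod>i\<in>{0..<n}. if i \<in> S then b i else a i)"
          using j by (subst (2) prod.remove[of _ j]) auto
        finally show ?thesis
          unfolding run Cons pmf_bind_Cons ab(4)[OF that] by simp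
      qed
      moreover have "\<forall>i. 0 \<le> a' i" "\<forall>i. 0 \<le> b' i"
        using ab by (auto simp: a'_def b'_def)
      ultimately show ?thesis using ab(1) by blast
    qed
  qed
qed

subsection \<open>A bound from elementary symmetric polynomials\<close>

text \<open>Double counting of pairs of a set of size \<open>Suc k\<close> and an element
  \<open>i\<close> of it, the set being written as \<open>insert i S\<close>.\<close>

lemma sum_subsets_insert:
  fixes \<rho> :: "'a \<Rightarrow> real"
  assumes "finite I"
  shows "real (Suc k) * (\<Sum>S | S \<subseteq> I \<and> card S = Suc k. \<Prod>i\<in>S. \<rho> i) =
    (\<Sum>i\<in>I. \<rho> i * (\<Sum>S | S \<subseteq> I \<and> card S = k \<and> i \<notin> S. \<Prod>i\<in>S. \<rho> i))"
proof -
  have fin: "finite {S. S \<subseteq> I \<and> P S}" for P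
    using assms(1) by simp
  have "(\<Sum>i\<in>I. \<rho> i * (\<Sum>S | S \<subseteq> I \<and> card S = k \<and> i \<notin> S. \<Prod>i\<in>S. \<rho> i)) =
      (\<Sum>i\<in>I. \<Sum>S | S \<subseteq> I \<and> card S = Suc k \<and> i \<in> S. \<Prod>i\<in>S. \<rho> i)"
  proof (rule sum.cong[OF refl])
    fix i assume i: "i \<in> I"
    have "\<rho> i * (\<Sum>S | S \<subseteq> I \<and> card S = k \<and> i \<notin> S. \<Prod>i\<in>S. \<rho> i) =
      (\<Sum>S | S \<subseteq> I \<and> card S = k \<and> i \<notin> S. \<Prod>i\<in>insert i S. \<rho> i)"
      unfolding sum_distrib_left using assms
      by (intro sum.cong) (auto dest: finite_subset)
    also have "\<dots> = (\<Sum>S | S \<subseteq> I \<and> card S = Suc k \<and> i \<in> S. \<Prod>i\<in>S. \<rho> i)"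
      by (rule sum.reindex_bij_witness[where i="\<lambda>S. S - {i}" and j="insert i"])
        (use assms i in \<open>auto simp: insert_absorb dest: finite_subset\<close>)
    finally show "\<rho> i * (\<Sum>S | S \<subseteq> I \<and> card S = k \<and> i \<notin> S. \<Prod>i\<in>S. \<rho> i) =
      (\<Sum>S | S \<subseteq> I \<and> card S = Suc k \<and> i \<in> S. \<Prod>i\<in>S. \<rho> i)" .
  qed
  also have "\<dots> = (\<Sum>i\<in>I. \<Sum>S | S \<in> {S. S \<subseteq> I \<and> card S = Suc k} \<and> i \<in> S. \<Prod>i\<in>S. \<rho> i)"
    by (simp add: conj_assoc)
  also have "\<dots> = (\<Sum>S | S \<subseteq> I \<and> card S = Suc k. \<Sum>i | i \<in> I \<and> i \<in> S. \<Prod>i\<in>S. \<rho> i)"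
    by (rule sum.swap_restrict[OF assms fin])
  also have "\<dots> = (\<Sum>S | S \<subseteq> I \<and> card S = Suc k. real (Suc k) * (\<Prod>i\<in>S. \<rho> i))"
  proof (rule sum.cong[OF refl])
    fix S assume "S \<in> {S. S \<subseteq> I \<and> card S = Suc k}"
    then have "{i. i \<in> I \<and> i \<in> S} = S" "card S = Suc k" by auto
    then show "(\<Sum>i | i \<in> I \<and> i \<in> S. \<Prod>i\<in>S. \<rho> i) = real (Suc k) * (\<Prod>i\<in>S. \<rho> i)" by simp
  qed
  finally show ?thesis by (simp add: sum_distrib_left)
qed

text \<open>Dropping the restriction \<open>i \<notin> S\<close> in the previous identity bounds
  \<open>(k + 1) e\<^sub>k\<^sub>+\<^sub>1\<close> by \<open>e\<^sub>1 e\<^sub>k\<close>; induction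
  then produces the factorial.\<close>

lemma sum_subsets_le_power:
  fixes \<rho> :: "'a \<Rightarrow> real"
  assumes "finite I" "\<And>i. i \<in> I \<Longrightarrow> 0 \<le> \<rho> i"
  shows "(\<Sum>S | S \<subseteq> I \<and> card S = k. \<Prod>i\<in>S. \<rho> i) \<le> (\<Sum>i\<in>I. \<rho> i) ^ k / fact k"
proof (induction k)
  case 0
  have "{S. S \<subseteq> I \<and> card S = 0} = {{}}" using assms(1) by (auto dest: finite_subset)
  then show ?case by simp
next
  case (Suc k)
  have fin: "finite {S. S \<subseteq> I \<and> P S}" for P
    using assms(1) by simp
  have "real (Suc k) * (\<Sum>S | S \<subseteq> I \<and> card S = Suc k. \<Prod>i\<in>S. \<rho> i) \<le>
    (\<Sum>i\<in>I. \<rho> i * (\<Sum>S | S \<subseteq> I \<and> card S = k. \<Prod>i\<in>S. \<rho> i))"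
    unfolding sum_subsets_insert[OF assms(1)] using assms
    by (intro sum_mono mult_left_mono sum_mono2 fin prod_nonneg) auto
  also have "\<dots> = (\<Sum>i\<in>I. \<rho> i) * (\<Sum>S | S \<subseteq> I \<and> card S = k. \<Prod>i\<in>S. \<rho> i)"
    by (simp add: sum_distrib_right)
  also have "\<dots> \<le> (\<Sum>i\<in>I. \<rho> i) * ((\<Sum>i\<in>I. \<rho> i) ^ k / fact k)"
    using Suc assms(2) by (intro mult_left_mono sum_nonneg) auto
  finally have "(\<Sum>S | S \<subseteq> I \<and> card S = Suc k. \<Prod>i\<in>S. \<rho> i) \<le>
      (\<Sum>i\<in>I. \<rho> i) * ((\<Sum>i\<in>I. \<rho> i) ^ k / fact k) / real (Suc k)"
    by (subst pos_le_divide_eq) (auto simp: mult.commute)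
  then show ?case by (simp add: mult.commute)
qed

text \<open>With \<open>\<rho> = b / a\<close>, the quantity bounded here is \<open>Q {}\<close> times the elementary symmetric
  polynomial \<open>e\<^sub>l(\<rho>)\<close> without the variable \<open>\<rho>\<^sub>i\<close>. If \<open>\<Sum>\<rho>\<close> is small, \<open>e\<^sub>l(\<rho>) \<le> (\<Sum>\<rho>)\<^sup>l/l!\<close> gives the first
  term; otherwise the second comes from averaging over \<open>i\<close> with weights \<open>\<rho>\<^sub>i\<close>.\<close>
lemma product_family_bound:
  fixes c :: real
  assumes "finite I" "I \<noteq> {}" "0 \<le> c" "\<And>i. 0 \<le> a i" "\<And>i. 0 \<le> b i" "0 < M"
    and Q: "\<And>S. S \<subseteq> I \<Longrightarrow> Q S = c * (\<Prod>i\<in>I. if i \<in> S then b i else a i)"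
  shows "\<exists>i\<in>I. (\<Sum>S | S \<subseteq> I \<and> card S = l \<and> i \<notin> S. Q S) \<le>
    M ^ l / fact l * Q {} + real (Suc l) / M * (\<Sum>S | S \<subseteq> I \<and> card S = Suc l. Q S)"
proof -
  have nonneg: "0 \<le> Q S" if "S \<subseteq> I" for S
    unfolding Q[OF that] using assms(3-5) by (intro mult_nonneg_nonneg prod_nonneg) auto
  show ?thesis
  proof (cases "\<forall>i\<in>I. 0 < a i")
    \<comment> \<open>The ratio \<open>b i / a i\<close> is undefined when \<open>a i = 0\<close>,
      but then \<open>t\<close> is impossible unless \<open>i\<close> is a leaker, so Eve is safe in
      naming \<open>i\<close>.\<close>
    case False
    then obtain i where i: "i \<in> I" "a i = 0" using assms(4) by (metis order_less_le)
    have "Q S = 0" if "S \<subseteq> I" "i \<notin> S" for S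
      unfolding Q[OF that(1)] using that(2) i assms(1) by (auto intro!: prod_zero bexI[of _ i])
    then have "(\<Sum>S | S \<subseteq> I \<and> card S = l \<and> i \<notin> S. Q S) = 0"
      by (intro sum.neutral) auto
    also have "0 \<le> M ^ l / fact l * Q {} + real (Suc l) / M * (\<Sum>S | S \<subseteq> I \<and> card S = Suc l. Q S)"
      using assms(6) by (intro add_nonneg_nonneg mult_nonneg_nonneg sum_nonneg nonneg) auto
    finally show ?thesis using i by blast
  next
    case True
    define \<rho> where "\<rho> i = b i / a i" for i
    have \<rho>: "0 \<le> \<rho> i" for i using assms(4,5) by (auto simp: \<rho>_def)
    have fin: "finite {S. S \<subseteq> I \<and> P S}" for P
      using assms(1) by simp
    define A where "A = Q {}"
    have A: "0 \<le> A" unfolding A_def by (rule nonneg) simp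
    have QA: "Q S = A * (\<Prod>i\<in>S. \<rho> i)" if "S \<subseteq> I" for S
    proof -
      have "(\<Prod>i\<in>I. if i \<in> S then b i else a i) = (\<Prod>i\<in>I. a i * (if i \<in> S then \<rho> i else 1))"
        using True by (intro prod.cong) (auto simp: \<rho>_def)
      also have "\<dots> = (\<Prod>i\<in>I. a i) * (\<Prod>i\<in>I \<inter> S. \<rho> i)"
        by (simp add: prod.distrib prod.inter_restrict[OF assms(1)])
      finally show ?thesis using that Q by (simp add: A_def Int_absorb1)
    qed
    define w where "w i = (\<Sum>S | S \<subseteq> I \<and> card S = l \<and> i \<notin> S. Q S)" for i
    define R where "R = (\<Sum>i\<in>I. \<rho> i)"
    define E where "E k = (\<Sum>S | S \<subseteq> I \<and> card S = k. Q S)" for k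
    have E_nonneg: "0 \<le> E k" for k unfolding E_def by (intro sum_nonneg nonneg) auto
    have E_eq: "E k = A * (\<Sum>S | S \<subseteq> I \<and> card S = k. \<Prod>i\<in>S. \<rho> i)" for k
      unfolding E_def by (simp add: QA sum_distrib_left)
    have w_eq: "w i = A * (\<Sum>S | S \<subseteq> I \<and> card S = l \<and> i \<notin> S. \<Prod>i\<in>S. \<rho> i)" for i
      unfolding w_def by (simp add: QA sum_distrib_left)
    \<comment> \<open>Eve's best guess: the player whose naming leaves the least winning
      weight.\<close>
    obtain i where i: "i \<in> I" "\<And>j. j \<in> I \<Longrightarrow> w i \<le> w j"
      using assms(1,2) by (metis finite_has_minimal arg_min_if_finite linorder_not_less)
    show ?thesis
    proof (cases "R \<le> M")
      case True
      have "w i \<le> E l"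
        unfolding w_def E_def by (intro sum_mono2 fin nonneg) auto
      also have "\<dots> \<le> A * (R ^ l / fact l)"
        unfolding E_eq R_def using assms(1) \<rho> A by (intro mult_left_mono sum_subsets_le_power) auto
      also have "\<dots> \<le> A * (M ^ l / fact l)"
        using True \<rho> A by (intro mult_left_mono divide_right_mono power_mono)
          (auto simp: R_def intro!: sum_nonneg)
      finally have "w i \<le> M ^ l / fact l * Q {} + real (Suc l) / M * E (Suc l)"
        using E_nonneg[of "Suc l"] assms(6)
        by (simp add: A_def mult.commute add_increasing2)
      then show ?thesis using i(1) unfolding w_def E_def by blast
    next
      case False
      have "w i * M \<le> w i * R"
        using False i(1) by (intro mult_left_mono) (auto simp: w_def intro!: sum_nonneg nonneg)
      also have "\<dots> = (\<Sum>j\<in>I. \<rho> j * w i)"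
        by (simp add: R_def sum_distrib_left mult.commute)
      also have "\<dots> \<le> (\<Sum>j\<in>I. \<rho> j * w j)"
        using \<rho> i by (intro sum_mono mult_left_mono) auto
      also have "\<dots> = real (Suc l) * E (Suc l)"
        using arg_cong[OF sum_subsets_insert[OF assms(1), of l \<rho>], of "(*) A"]
        by (simp add: w_eq E_eq sum_distrib_left mult_ac)
      finally have "w i \<le> real (Suc l) / M * E (Suc l)"
        using assms(6) by (simp add: field_simps)
      also have "\<dots> \<le> M ^ l / fact l * Q {} + real (Suc l) / M * E (Suc l)"
        using assms(6) A by (simp add: A_def)
      finally show ?thesis using i(1) unfolding w_def E_def by blast
    qed
  qed
qed

subsection \<open>The game with an arbitrary weight on the leaker sets\<close>

text \<open>The weights need not sum to 1, so that the game remaining after a partial transcript,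
  with its unnormalised posterior weights, is again of this form. \<open>W S\<close> is counted once
  for each secret, hence the factor \<open>real N\<close> in \<open>uniform_weight\<close>.\<close>

definition payoff :: "nat \<Rightarrow> nat \<Rightarrow> (nat set \<Rightarrow> real) \<Rightarrow> protocol \<Rightarrow> (nat list \<Rightarrow> nat) \<Rightarrow>
    (nat list \<Rightarrow> nat \<Rightarrow> nat) \<Rightarrow> real" where
  "payoff n N W \<pi> f g = (\<Sum>x\<in>{1..N}. \<Sum>S\<in>Pow {0..<n}.
     W S * measure_pmf.prob (transcript \<pi> x S) {t. f t = x \<and> g t (f t) \<notin> S})"

abbreviation guesses :: "nat \<Rightarrow> (nat list \<Rightarrow> nat \<Rightarrow> nat) set" where
  "guesses n \<equiv> {g. \<forall>t y. g t y < n}"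

definition opt_value :: "nat \<Rightarrow> nat \<Rightarrow> (nat set \<Rightarrow> real) \<Rightarrow> real" where
  "opt_value n N W = (SUP \<pi> \<in> {\<pi>. valid_protocol n \<pi>}. SUP f. INF g \<in> guesses n. payoff n N W \<pi> f g)"

definition uniform_weight :: "nat \<Rightarrow> nat \<Rightarrow> nat \<Rightarrow> nat set \<Rightarrow> real" where
  "uniform_weight N l n S = of_bool (card S = l) / (real N * real (n choose l))"

lemma payoff_nonneg: "(\<And>S. 0 \<le> W S) \<Longrightarrow> 0 \<le> payoff n N W \<pi> f g"
  unfolding payoff_def by (intro sum_nonneg mult_nonneg_nonneg) auto

lemma payoff_le_total:
  assumes "\<And>S. 0 \<le> W S"
  shows "payoff n N W \<pi> f g \<le> real N * (\<Sum>S\<in>Pow {0..<n}. W S)"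
proof -
  have "payoff n N W \<pi> f g \<le> (\<Sum>x\<in>{1..N}. \<Sum>S\<in>Pow {0..<n}. W S)"
    unfolding payoff_def using assms by (intro sum_mono mult_left_le) auto
  then show ?thesis by simp
qed

lemma guesses_nonempty: "0 < n \<Longrightarrow> guesses n \<noteq> {}"
  by (auto intro!: exI[of _ "\<lambda>_ _. 0"])

lemma valid_protocols_nonempty: "{\<pi>. valid_protocol n \<pi>} \<noteq> {}"
  by (auto simp: valid_protocol_def intro!: exI[of _ "\<lambda>_. None"])

context
  fixes n N :: nat and W :: "nat set \<Rightarrow> real"
  assumes W: "\<And>S. 0 \<le> W S"
begin

lemma bdd_below_payoff: "bdd_below (payoff n N W \<pi> f ` G)"
  using payoff_nonneg[of W, OF W] by (auto intro!: bdd_belowI[of _ 0])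

lemma INF_payoff_le:
  assumes "0 < n"
  shows "(INF g \<in> guesses n. payoff n N W \<pi> f g) \<le> real N * (\<Sum>S\<in>Pow {0..<n}. W S)"
  using guesses_nonempty[OF assms] payoff_le_total[of W, OF W]
  by (meson bdd_below_payoff cINF_lower2 ex_in_conv)

lemma opt_value_upper:
  assumes "\<And>\<pi> f. valid_protocol n \<pi> \<Longrightarrow> \<exists>g\<in>guesses n. payoff n N W \<pi> f g \<le> c"
  shows "opt_value n N W \<le> c"
  unfolding opt_value_def
proof (intro cSUP_least valid_protocols_nonempty)
  fix \<pi> :: protocol and f :: "nat list \<Rightarrow> nat"
  assume "\<pi> \<in> {\<pi>. valid_protocol n \<pi>}"
  then obtain g where "g \<in> guesses n" "payoff n N W \<pi> f g \<le> c"
    using assms by blast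
  then show "(INF g \<in> guesses n. payoff n N W \<pi> f g) \<le> c"
    by (intro cINF_lower2[OF bdd_below_payoff])
qed auto

lemma opt_value_lower:
  assumes "0 < n" "valid_protocol n \<pi>" "\<And>g. g \<in> guesses n \<Longrightarrow> c \<le> payoff n N W \<pi> f g"
  shows "c \<le> opt_value n N W"
proof -
  let ?B = "real N * (\<Sum>S\<in>Pow {0..<n}. W S)"
  have "c \<le> (INF g \<in> guesses n. payoff n N W \<pi> f g)"
    using assms(3) by (rule cINF_greatest[OF guesses_nonempty[OF assms(1)]])
  also have "\<dots> \<le> (SUP f. INF g \<in> guesses n. payoff n N W \<pi> f g)"
    by (rule cSUP_upper) (auto intro!: bdd_aboveI2[where M="?B"] INF_payoff_le[OF assms(1)])
  also have "\<dots> \<le> opt_value n N W"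
    unfolding opt_value_def using assms(2)
    by (intro cSUP_upper) (auto intro!: bdd_aboveI2[where M="?B"] cSUP_least INF_payoff_le[OF assms(1)])
  finally show ?thesis .
qed

lemma opt_value_approx:
  assumes "c < opt_value n N W"
  obtains \<pi> f where "valid_protocol n \<pi>" "\<And>g. g \<in> guesses n \<Longrightarrow> c < payoff n N W \<pi> f g"
proof -
  obtain \<pi> f where \<pi>: "valid_protocol n \<pi>" "c < (INF g \<in> guesses n. payoff n N W \<pi> f g)"
  proof (rule ccontr)
    assume "\<not> thesis"
    with that have "\<And>\<pi> f. valid_protocol n \<pi> \<Longrightarrow> (INF g \<in> guesses n. payoff n N W \<pi> f g) \<le> c"
      by (meson linorder_not_less)
    then have "opt_value n N W \<le> c"
      unfolding opt_value_def by (intro cSUP_least valid_protocols_nonempty) auto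
    with assms show False by simp
  qed
  show thesis
  proof (rule that[OF \<pi>(1)])
    fix g assume "g \<in> guesses n"
    then have "(INF g \<in> guesses n. payoff n N W \<pi> f g) \<le> payoff n N W \<pi> f g"
      by (intro cINF_lower bdd_below_payoff)
    with \<pi>(2) show "c < payoff n N W \<pi> f g" by simp
  qed
qed

end

text \<open>Simulation argument: the players imitate a good strategy of the old game, and each reply
  of Eve in the new game is pulled back to a reply in the old one that does comparably well for
  her.\<close>

lemma opt_value_transport:
  assumes "\<And>S. 0 \<le> W S" "\<And>S. 0 \<le> W' S" "0 < n'" "0 < k"
    and transport: "\<And>\<pi> f. valid_protocol n \<pi> \<Longrightarrow> \<exists>\<pi>' f'. valid_protocol n' \<pi>' \<and>
      (\<forall>g'\<in>guesses n'. \<exists>g\<in>guesses n. k * payoff n N W \<pi> f g \<le> payoff n' N' W' \<pi>' f' g')"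
  shows "k * opt_value n N W \<le> opt_value n' N' W'"
proof -
  have "opt_value n N W \<le> opt_value n' N' W' / k"
  \<comment> \<open>Optimal strategies need not exist, so one works with every \<open>c\<close>
    strictly below the supremum.\<close>
  proof (rule dense_le)
    fix c assume "c < opt_value n N W"
    then obtain \<pi> f where \<pi>: "valid_protocol n \<pi>" "\<And>g. g \<in> guesses n \<Longrightarrow> c < payoff n N W \<pi> f g"
      by (rule opt_value_approx[of W, OF assms(1)]) blast
    obtain \<pi>' f' where \<pi>': "valid_protocol n' \<pi>'" "\<And>g'. g' \<in> guesses n' \<Longrightarrow>
        \<exists>g\<in>guesses n. k * payoff n N W \<pi> f g \<le> payoff n' N' W' \<pi>' f' g'"
      using transport[OF \<pi>(1), of f] by blast
    have "k * c \<le> opt_value n' N' W'"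
    proof (rule opt_value_lower[of W', OF assms(2,3) \<pi>'(1)])
      fix g' assume "g' \<in> guesses n'"
      then obtain g where "g \<in> guesses n" "k * payoff n N W \<pi> f g \<le> payoff n' N' W' \<pi>' f' g'"
        using \<pi>'(2) by blast
      then show "k * c \<le> payoff n' N' W' \<pi>' f' g'"
        using \<pi>(2)[of g] assms(4) by (meson mult_le_cancel_left_pos less_imp_le order_trans)
    qed
    then show "c \<le> opt_value n' N' W' / k"
      using assms(4) by (simp add: field_simps)
  qed
  then show ?thesis using assms(4) by (simp add: field_simps)
qed

lemma payoff_mono:
  assumes "\<And>S. S \<subseteq> {0..<n} \<Longrightarrow> k * W S \<le> W' S"
  shows "k * payoff n N W \<pi> f g \<le> payoff n N W' \<pi> f g"
proof -
  have "k * payoff n N W \<pi> f g = (\<Sum>x\<in>{1..N}. \<Sum>S\<in>Pow {0..<n}.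
     k * W S * measure_pmf.prob (transcript \<pi> x S) {t. f t = x \<and> g t (f t) \<notin> S})"
    by (simp add: payoff_def sum_distrib_left mult.assoc)
  also have "\<dots> \<le> payoff n N W' \<pi> f g"
    unfolding payoff_def using assms by (intro sum_mono mult_right_mono) auto
  finally show ?thesis .
qed

lemma opt_value_mono:
  assumes "0 < n" "0 < k" "\<And>S. 0 \<le> W S" "\<And>S. 0 \<le> W' S" "\<And>S. S \<subseteq> {0..<n} \<Longrightarrow> k * W S \<le> W' S"
  shows "k * opt_value n N W \<le> opt_value n N W'"
  using assms(1-4) payoff_mono[of n k W W', OF assms(5)] by (intro opt_value_transport) blast+

section \<open>Splitting a game by a claim that only a non-leaker can make\<close>

definition ring_protocol :: "nat \<Rightarrow> real \<Rightarrow> protocol \<Rightarrow> protocol \<Rightarrow> protocol" where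
  "ring_protocol j \<epsilon> \<pi>1 \<pi>2 t = (case t of
     [] \<Rightarrow> Some (j, map_pmf of_bool (bernoulli_pmf \<epsilon>), \<lambda>_. return_pmf 0)
   | m # u \<Rightarrow> (if m = 1 then \<pi>1 else \<pi>2) u)"

lemma
  assumes "valid_protocol n \<pi>1" "valid_protocol n \<pi>2" "j < n"
  shows valid_ring_protocol: "valid_protocol n (ring_protocol j \<epsilon> \<pi>1 \<pi>2)"
    and transcript_ring_protocol: "transcript (ring_protocol j \<epsilon> \<pi>1 \<pi>2) x S =
      bind_pmf (if j \<in> S then return_pmf 0 else map_pmf of_bool (bernoulli_pmf \<epsilon>))
        (\<lambda>m. map_pmf ((#) m) (transcript (if m = 1 then \<pi>1 else \<pi>2) x S))"
proof -
  let ?\<pi> = "ring_protocol j \<epsilon> \<pi>1 \<pi>2"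
  obtain len1 len2 where len: "\<And>t. len1 \<le> length t \<Longrightarrow> \<pi>1 t = None" "\<And>t. len2 \<le> length t \<Longrightarrow> \<pi>2 t = None"
    using assms by (auto simp: valid_protocol_def)
  \<comment> \<open>A common bound on both continuations, so that the number of rounds does not
    depend on the first message.\<close>
  define K where "K = max len1 len2"
  have stop: "?\<pi> t = None" if "Suc K \<le> length t" for t
    using that len by (auto simp: ring_protocol_def K_def split: list.split)
  have step: "i < n \<and> finite (set_pmf p0) \<and> (\<forall>x. finite (set_pmf (p x)))"
    if "?\<pi> t = Some (i, p0, p)" for t i p0 p
  proof (cases t)
    case Nil
    then show ?thesis using that assms(3) by (auto simp: ring_protocol_def)
  next
    case (Cons m u)
    then have "\<pi>1 u = Some (i, p0, p) \<or> \<pi>2 u = Some (i, p0, p)"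
      using that by (auto simp: ring_protocol_def split: if_splits)
    then show ?thesis using assms(1,2) unfolding valid_protocol_def by blast
  qed
  show "valid_protocol n ?\<pi>"
    unfolding valid_protocol_def using stop step by blast
  have sub: "run (if m = 1 then \<pi>1 else \<pi>2) x S K [] = transcript (if m = 1 then \<pi>1 else \<pi>2) x S" for m
    using transcript_eq_run[of len1 \<pi>1 K, OF len(1)] transcript_eq_run[of len2 \<pi>2 K, OF len(2)]
    by (simp add: K_def)
  have "transcript ?\<pi> x S = run ?\<pi> x S (Suc K) []"
    using stop by (rule transcript_eq_run) auto
  also have "\<dots> = bind_pmf (if j \<in> S then return_pmf 0 else map_pmf of_bool (bernoulli_pmf \<epsilon>))
        (\<lambda>m. map_pmf ((#) m) (run (if m = 1 then \<pi>1 else \<pi>2) x S K []))"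
    by (simp add: ring_protocol_def run_Cons)
  finally show "transcript ?\<pi> x S =
      bind_pmf (if j \<in> S then return_pmf 0 else map_pmf of_bool (bernoulli_pmf \<epsilon>))
        (\<lambda>m. map_pmf ((#) m) (transcript (if m = 1 then \<pi>1 else \<pi>2) x S))"
    unfolding sub .
qed

text \<open>The two weights are those of the leaker sets after player \<open>j\<close> did, respectively did not, claim to be no
  leaker, when non-leakers do so with probability \<open>\<epsilon>\<close> and leakers never do.\<close>
lemma opt_value_ring:
  assumes "j < n" "0 \<le> \<epsilon>" "\<epsilon> \<le> 1" and W: "\<And>S. 0 \<le> W S"
  shows "opt_value n N (\<lambda>S. W S * (if j \<in> S then 0 else \<epsilon>)) +
      opt_value n N (\<lambda>S. W S * (if j \<in> S then 1 else 1 - \<epsilon>)) \<le> opt_value n N W"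
    (is "opt_value n N ?W1 + opt_value n N ?W2 \<le> _")
proof -
  have nonneg: "0 \<le> ?W1 S" "0 \<le> ?W2 S" for S using assms by auto
  have *: "c1 + c2 \<le> opt_value n N W" if c: "c1 < opt_value n N ?W1" "c2 < opt_value n N ?W2" for c1 c2
  proof -
    obtain \<pi>1 f1 where \<pi>1: "valid_protocol n \<pi>1"
        "\<And>g. g \<in> guesses n \<Longrightarrow> c1 < payoff n N ?W1 \<pi>1 f1 g"
      using opt_value_approx[of ?W1, OF nonneg(1) c(1)] by blast
    obtain \<pi>2 f2 where \<pi>2: "valid_protocol n \<pi>2"
        "\<And>g. g \<in> guesses n \<Longrightarrow> c2 < payoff n N ?W2 \<pi>2 f2 g"
      using opt_value_approx[of ?W2, OF nonneg(2) c(2)] by blast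
    let ?\<pi> = "ring_protocol j \<epsilon> \<pi>1 \<pi>2"
    \<comment> \<open>Frank reads off the first message which subgame was played. Eve's guess
      \<open>g\<close> splits likewise into \<open>g1\<close> and \<open>g2\<close>, so the payoffs
      of the two subgames add up.\<close>
    define f where "f t = (if hd t = 1 then f1 (tl t) else f2 (tl t))" for t :: "nat list"
    show ?thesis
    proof (rule opt_value_lower[of W, OF W])
      show "0 < n" using assms(1) by simp
      show "valid_protocol n ?\<pi>" by (rule valid_ring_protocol[OF \<pi>1(1) \<pi>2(1) assms(1)])
      fix g assume g: "g \<in> guesses n"
      define g1 where "g1 t = g (1 # t)" for t
      define g2 where "g2 t = g (0 # t)" for t
      define P1 where "P1 x S = measure_pmf.prob (transcript \<pi>1 x S) {t. f1 t = x \<and> g1 t (f1 t) \<notin> S}" for x S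
      define P2 where "P2 x S = measure_pmf.prob (transcript \<pi>2 x S) {t. f2 t = x \<and> g2 t (f2 t) \<notin> S}" for x S
      have "W S * measure_pmf.prob (transcript ?\<pi> x S) {t. f t = x \<and> g t (f t) \<notin> S} =
          ?W1 S * P1 x S + ?W2 S * P2 x S" for x S
        unfolding transcript_ring_protocol[OF \<pi>1(1) \<pi>2(1) assms(1)] P1_def P2_def g1_def g2_def
        using assms(2,3)
        by (auto simp: bind_return_pmf bind_map_pmf prob_bind_bernoulli f_def vimage_def algebra_simps)
      then have "payoff n N W ?\<pi> f g = payoff n N ?W1 \<pi>1 f1 g1 + payoff n N ?W2 \<pi>2 f2 g2"
        by (simp add: payoff_def sum.distrib flip: P1_def P2_def)
      moreover have "g1 \<in> guesses n" "g2 \<in> guesses n" using g by (auto simp: g1_def g2_def)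
      ultimately show "c1 + c2 \<le> payoff n N W ?\<pi> f g"
        using \<pi>1(2)[of g1] \<pi>2(2)[of g2] by linarith
    qed
  qed
  have "opt_value n N ?W1 \<le> opt_value n N W - opt_value n N ?W2"
  proof (rule dense_le)
    fix c1 assume c1: "c1 < opt_value n N ?W1"
    have "opt_value n N ?W2 \<le> opt_value n N W - c1"
      by (rule dense_le) (use *[OF c1] in \<open>simp add: algebra_simps\<close>)
    then show "c1 \<le> opt_value n N W - opt_value n N ?W2" by simp
  qed
  then show ?thesis by simp
qed

subsection \<open>Monotonicity in the number of players\<close>

definition relabel :: "(nat \<Rightarrow> nat) \<Rightarrow> protocol \<Rightarrow> protocol" where
  "relabel \<sigma> \<pi> t = map_option (\<lambda>(i, p0, p). (\<sigma> i, p0, p)) (\<pi> t)"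

lemma transcript_relabel: "transcript (relabel \<sigma> \<pi>) x S = transcript \<pi> x (\<sigma> -` S)"
proof -
  have "run (relabel \<sigma> \<pi>) x S k t = run \<pi> x (\<sigma> -` S) k t" for k t
    by (induction k arbitrary: t) (simp_all add: relabel_def split: option.split)
  moreover have "protocol_length (relabel \<sigma> \<pi>) = protocol_length \<pi>"
    by (simp add: protocol_length_def relabel_def)
  ultimately show ?thesis by simp
qed

lemma valid_relabel:
  assumes "valid_protocol n \<pi>" "\<And>i. i < n \<Longrightarrow> \<sigma> i < n'"
  shows "valid_protocol n' (relabel \<sigma> \<pi>)"
  using assms unfolding valid_protocol_def relabel_def by fastforce

text \<open>The transposition seats the \<open>n\<close> old players on all seats of
  \<open>{0..<Suc n}\<close> except \<open>j\<close>. Player \<open>j\<close> stays silent, and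
  leaker sets containing \<open>j\<close> are simply given up.\<close>

lemma opt_value_add_player:
  assumes "0 < n" "j \<le> n" "0 < k" and W: "\<And>S. 0 \<le> W S" and W': "\<And>S. 0 \<le> W' S"
    and le: "\<And>S. S \<subseteq> {0..<n} \<Longrightarrow> k * W S \<le> W' (Transposition.transpose j n ` S)"
  shows "k * opt_value n N W \<le> opt_value (Suc n) N W'"
proof (rule opt_value_transport[OF W W'])
  let ?\<sigma> = "Transposition.transpose j n"
  have inv: "?\<sigma> -` ?\<sigma> ` S = S" for S by (simp add: inj_vimage_image_eq)
  fix \<pi> :: protocol and f :: "nat list \<Rightarrow> nat"
  assume \<pi>: "valid_protocol n \<pi>"
  have "valid_protocol (Suc n) (relabel ?\<sigma> \<pi>)"
    using assms(2) by (intro valid_relabel[OF \<pi>]) (auto simp: Transposition.transpose_def)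
  moreover have "\<exists>g\<in>guesses n. k * payoff n N W \<pi> f g \<le> payoff (Suc n) N W' (relabel ?\<sigma> \<pi>) f g'" for g'
  proof
    define g where "g t y = (if ?\<sigma> (g' t y) < n then ?\<sigma> (g' t y) else 0)" for t :: "nat list" and y :: nat
    show "g \<in> guesses n" using assms(1) by (auto simp: g_def)
    define P where "P x S = measure_pmf.prob (transcript (relabel ?\<sigma> \<pi>) x S) {t. f t = x \<and> g' t (f t) \<notin> S}" for x S
    have sub: "(`) ?\<sigma> ` Pow {0..<n} \<subseteq> Pow {0..<Suc n}"
      using assms(2) by (auto simp: Transposition.transpose_def)
    have "k * payoff n N W \<pi> f g \<le> (\<Sum>x\<in>{1..N}. \<Sum>S\<in>Pow {0..<n}. W' (?\<sigma> ` S) * P x (?\<sigma> ` S))"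
      unfolding payoff_def sum_distrib_left
    proof (intro sum_mono)
      fix x S assume S: "S \<in> Pow {0..<n}"
      have "measure_pmf.prob (transcript \<pi> x S) {t. f t = x \<and> g t (f t) \<notin> S} \<le> P x (?\<sigma> ` S)"
        unfolding P_def transcript_relabel inv
      proof (rule measure_pmf.finite_measure_mono)
        show "{t. f t = x \<and> g t (f t) \<notin> S} \<subseteq> {t. f t = x \<and> g' t (f t) \<notin> ?\<sigma> ` S}"
          using S by (fastforce simp: g_def)
      qed simp
      then have "(k * W S) * measure_pmf.prob (transcript \<pi> x S) {t. f t = x \<and> g t (f t) \<notin> S} \<le>
          W' (?\<sigma> ` S) * P x (?\<sigma> ` S)"
        using le[of S] S assms(3) W W' by (intro mult_mono) auto
      then show "k * (W S * measure_pmf.prob (transcript \<pi> x S) {t. f t = x \<and> g t (f t) \<notin> S}) \<le>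
          W' (?\<sigma> ` S) * P x (?\<sigma> ` S)" by (simp only: mult.assoc)
    qed
    also have "\<dots> = (\<Sum>x\<in>{1..N}. \<Sum>S\<in>(`) ?\<sigma> ` Pow {0..<n}. W' S * P x S)"
      by (subst sum.reindex) (auto intro!: inj_on_subset[OF inj_on_image_Pow[of _ UNIV]])
    also have "\<dots> \<le> payoff (Suc n) N W' (relabel ?\<sigma> \<pi>) f g'"
      unfolding payoff_def P_def[symmetric]
      by (intro sum_mono sum_mono2 sub) (auto simp: P_def intro!: mult_nonneg_nonneg W')
    finally show "k * payoff n N W \<pi> f g \<le> payoff (Suc n) N W' (relabel ?\<sigma> \<pi>) f g'" .
  qed
  ultimately show "\<exists>\<pi>' f'. valid_protocol (Suc n) \<pi>' \<and> (\<forall>g'\<in>guesses (Suc n). \<exists>g\<in>guesses n.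
      k * payoff n N W \<pi> f g \<le> payoff (Suc n) N W' \<pi>' f' g')"
    by blast
qed (use assms in auto)

lemma opt_value_nonneg:
  assumes "0 < n" "\<And>S. 0 \<le> W S"
  shows "0 \<le> opt_value n N W"
proof -
  obtain \<pi> where "valid_protocol n \<pi>" using valid_protocols_nonempty by blast
  then show ?thesis
    using assms by (intro opt_value_lower[of W, OF assms(2)]) (auto intro!: payoff_nonneg)
qed

lemma uniform_weight_nonneg: "0 \<le> uniform_weight N l n S"
  by (simp add: uniform_weight_def)

text \<open>The factor is the probability that a given one of the \<open>Suc n\<close> players is no
  leaker.\<close>

lemma uniform_weight_Suc:
  assumes "l \<le> n"
  shows "uniform_weight N l (Suc n) S = real (Suc n - l) / real (Suc n) * uniform_weight N l n S"
proof -
  have "(Suc n - l) * (Suc n choose l) = Suc n * (n choose l)"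
    using binomial_absorb_comp[of "Suc n" l] by simp
  then have *: "real (Suc n - l) * real (Suc n choose l) = real (Suc n) * real (n choose l)"
    by (metis of_nat_mult)
  have pos: "0 < real (Suc n choose l)" "0 < real (n choose l)" using assms by (auto simp del: binomial_Suc_Suc)
  have eq: "1 / real (Suc n choose l) = real (Suc n - l) / real (Suc n) * (1 / real (n choose l))"
    using * pos by (simp add: field_simps del: binomial_Suc_Suc of_nat_Suc)
  have weight: "uniform_weight N l m S = of_bool (card S = l) / real N * (1 / real (m choose l))" for m
    by (simp add: uniform_weight_def)
  show ?thesis unfolding weight eq by (simp only: mult_ac)
qed

text \<open>Let the players take turns in claiming, with small probability, to be no leaker. Once someone has done so,
  the remaining \<open>n\<close> players run a protocol for \<open>n\<close> players; if nobody has, the round is almost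
  uninformative and the game starts afresh.\<close>
lemma opt_value_uniform_Suc_approx:
  assumes "0 < n" "l \<le> n" "0 < \<epsilon>" "\<epsilon> < 1"
  shows "(1 - \<epsilon>) ^ (Suc n - l) * opt_value n N (uniform_weight N l n) \<le>
    opt_value (Suc n) N (uniform_weight N l (Suc n))"
proof -
  define d where "d = Suc n - l"
  define u where "u = uniform_weight N l (Suc n)"
  define V where "V = opt_value n N (uniform_weight N l n)"
  \<comment> \<open>A lower bound on the chance that a given player is the first to make the claim:
    he is no leaker, the non-leakers before him, at most \<open>d\<close> in number, stay silent,
    and he speaks up.\<close>
  define k where "k = \<epsilon> * (1 - \<epsilon>) ^ d * (real d / real (Suc n))"
  \<comment> \<open>The weight of \<open>S\<close> after players \<open>0..<m\<close> all declined
    to make the claim.\<close>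
  define rest where "rest m S = u S * (1 - \<epsilon>) ^ card ({..<m} - S)" for m S
  have d: "0 < d" using assms by (simp add: d_def)
  have k: "0 < k" using assms d by (simp add: k_def)
  have u_nonneg: "0 \<le> u S" for S by (simp add: u_def uniform_weight_nonneg)
  have rest_nonneg: "0 \<le> rest m S" for m S using u_nonneg assms by (simp add: rest_def)
  have rest_ge: "(1 - \<epsilon>) ^ d * u S \<le> rest m S" if "S \<subseteq> {0..<Suc n}" "m \<le> Suc n" for m S
  proof (cases "card S = l")
    case True
    have "card ({..<m} - S) \<le> card ({0..<Suc n} - S)"
      using that by (intro card_mono) auto
    also have "\<dots> = d"
      using that True by (subst card_Diff_subset) (auto simp: d_def dest: finite_subset)
    finally show ?thesis
      unfolding rest_def mult.commute[of _ "u S"] using assms u_nonneg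
      by (intro mult_left_mono power_decreasing) auto
  qed (simp add: rest_def u_def uniform_weight_def)
  \<comment> \<open>Induction on the number of players already asked: each contributes at least
    \<open>k * V\<close>, and the unresolved game continues with \<open>rest m\<close>.\<close>
  have "opt_value (Suc n) N (rest m) + real m * (k * V) \<le> opt_value (Suc n) N u" if "m \<le> Suc n" for m
    using that
  proof (induction m)
    case 0
    then show ?case by (simp add: rest_def)
  next
    case (Suc m)
    let ?ring = "\<lambda>S. rest m S * (if m \<in> S then 0 else \<epsilon>)"
    \<comment> \<open>Player \<open>m\<close> has just cleared himself; the other \<open>n\<close>
      players now play the \<open>n\<close>-player game.\<close>
    have "k * V \<le> opt_value (Suc n) N ?ring"
      unfolding V_def
    proof (rule opt_value_add_player)
      fix S assume S: "S \<subseteq> {0..<n}"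
      let ?S = "Transposition.transpose m n ` S"
      have m: "m \<notin> ?S"
        using S by (metis atLeastLessThan_iff imageE less_irrefl subsetD transpose_apply_first transpose_involutory)
      have "?S \<subseteq> {0..<Suc n}" using S Suc.prems by (auto simp: Transposition.transpose_def)
      have "card ?S = card S" by (simp add: card_image)
      then have "u ?S = real d / real (Suc n) * uniform_weight N l n S"
        using uniform_weight_Suc[OF assms(2), of N ?S] by (simp add: u_def d_def uniform_weight_def)
      then have "k * uniform_weight N l n S = (1 - \<epsilon>) ^ d * u ?S * \<epsilon>"
        by (simp add: k_def)
      also have "\<dots> \<le> rest m ?S * \<epsilon>"
        using assms Suc.prems by (intro mult_right_mono rest_ge \<open>?S \<subseteq> {0..<Suc n}\<close>) auto
      finally show "k * uniform_weight N l n S \<le> rest m ?S * (if m \<in> ?S then 0 else \<epsilon>)"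
        using m by simp
    qed (use assms k Suc.prems rest_nonneg uniform_weight_nonneg in auto)
    moreover have "rest (Suc m) = (\<lambda>S. rest m S * (if m \<in> S then 1 else 1 - \<epsilon>))"
    proof
      fix S show "rest (Suc m) S = rest m S * (if m \<in> S then 1 else 1 - \<epsilon>)"
        by (simp add: rest_def lessThan_Suc insert_Diff_if)
    qed
    moreover have "opt_value (Suc n) N ?ring +
        opt_value (Suc n) N (\<lambda>S. rest m S * (if m \<in> S then 1 else 1 - \<epsilon>)) \<le> opt_value (Suc n) N (rest m)"
      using assms Suc.prems rest_nonneg by (intro opt_value_ring) auto
    ultimately show ?case using Suc by (simp add: distrib_right)
  qed
  from this[of "Suc n"]
  have "opt_value (Suc n) N (rest (Suc n)) + real (Suc n) * (k * V) \<le> opt_value (Suc n) N u" by simp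
  \<comment> \<open>After a fruitless round the weights still dominate a multiple of the original
    ones, so the value of the whole game bounds itself from below; Bernoulli's inequality then lets
    \<open>real d * \<epsilon>\<close> cancel.\<close>
  moreover have "(1 - \<epsilon>) ^ d * opt_value (Suc n) N u \<le> opt_value (Suc n) N (rest (Suc n))"
    using assms u_nonneg rest_nonneg rest_ge by (intro opt_value_mono) auto
  moreover have "real (Suc n) * (k * V) = real d * \<epsilon> * ((1 - \<epsilon>) ^ d * V)"
    by (simp add: k_def del: of_nat_Suc)
  ultimately have "real d * \<epsilon> * ((1 - \<epsilon>) ^ d * V) \<le> (1 - (1 - \<epsilon>) ^ d) * opt_value (Suc n) N u"
    by (simp add: algebra_simps)
  also have "\<dots> \<le> (real d * \<epsilon>) * opt_value (Suc n) N u"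
    using Bernoulli_inequality[of "-\<epsilon>" d] assms u_nonneg
    by (intro mult_right_mono opt_value_nonneg) auto
  finally show ?thesis
    using d assms by (simp add: d_def u_def V_def)
qed

lemma opt_value_uniform_Suc:
  assumes "0 < n" "l \<le> n"
  shows "opt_value n N (uniform_weight N l n) \<le> opt_value (Suc n) N (uniform_weight N l (Suc n))"
proof (rule tendsto_upperbound)
  let ?V = "opt_value n N (uniform_weight N l n)"
  have "((\<lambda>\<epsilon>. (1 - \<epsilon>) ^ (Suc n - l) * ?V) \<longlongrightarrow> (1 - 0) ^ (Suc n - l) * ?V) (at_right 0)"
    by (intro tendsto_intros)
  then show "((\<lambda>\<epsilon>. (1 - \<epsilon>) ^ (Suc n - l) * ?V) \<longlongrightarrow> ?V) (at_right 0)" by simp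
  show "\<forall>\<^sub>F \<epsilon> in at_right 0. (1 - \<epsilon>) ^ (Suc n - l) * ?V \<le> opt_value (Suc n) N (uniform_weight N l (Suc n))"
    unfolding eventually_at_right_field using opt_value_uniform_Suc_approx[OF assms]
    by (intro exI[of _ 1]) auto
qed simp

subsection \<open>The upper bound\<close>

lemma prob_eq_sum:
  assumes "finite T" "set_pmf p \<subseteq> T"
  shows "measure_pmf.prob p A = (\<Sum>t\<in>T. of_bool (t \<in> A) * pmf p t)"
proof -
  have "measure_pmf.prob p A = measure_pmf.prob p (A \<inter> T)"
    using assms(2) by (intro measure_prob_cong_0) (auto simp: pmf_eq_0_set_pmf)
  also have "\<dots> = (\<Sum>t\<in>T \<inter> A. pmf p t)"
    using assms(1) by (simp add: measure_measure_pmf_finite Int_commute)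
  also have "\<dots> = (\<Sum>t\<in>T. of_bool (t \<in> A) * pmf p t)"
    unfolding sum.inter_restrict[OF assms(1)] by (intro sum.cong) auto
  finally show ?thesis .
qed

lemma sum_pmf_le_1: "finite T \<Longrightarrow> (\<Sum>t\<in>T. pmf p t) \<le> 1"
  by (simp flip: measure_measure_pmf_finite)

text \<open>\<open>product_family_bound\<close> is applied at each transcript with secret
  \<open>f t\<close> and summed. The first terms add up to at most \<open>M ^ l / fact l\<close>;
  the second ones are total probabilities of games with \<open>l + 1\<close> leakers.\<close>

lemma opt_value_uniform_le:
  assumes "0 < n" "l \<le> n" "0 < N" "0 < \<tau>"
  shows "opt_value n N (uniform_weight N l n) \<le>
    real n ^ l / (fact l * real (n choose l)) * (\<tau> ^ l / real N) + 1 / \<tau>"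
proof (rule opt_value_upper)
  fix \<pi> :: protocol and f :: "nat list \<Rightarrow> nat"
  assume \<pi>: "valid_protocol n \<pi>"
  define q where "q x S t = pmf (transcript \<pi> x S) t" for x S t
  \<comment> \<open>The threshold \<tau> on the average likelihood ratio, turned into one on the sum
    over the \<open>n\<close> players.\<close>
  define M where "M = real n * \<tau>"
  define Sub where "Sub k = {S. S \<subseteq> {0..<n} \<and> card S = k}" for k
  have fin_Sub: "finite (Sub k)" for k by (simp add: Sub_def)
  have card_Sub: "card (Sub k) = n choose k" for k by (simp add: Sub_def n_subsets)
  have M: "0 < M" using assms by (simp add: M_def)
  have "\<exists>i\<in>{0..<n}. (\<Sum>S | S \<subseteq> {0..<n} \<and> card S = l \<and> i \<notin> S. q (f t) S t) \<le>
    M ^ l / fact l * q (f t) {} t + real (Suc l) / M * (\<Sum>S | S \<subseteq> {0..<n} \<and> card S = Suc l. q (f t) S t)" for t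
  proof -
    have "\<exists>c a b. 0 \<le> c \<and> (\<forall>i. 0 \<le> a i) \<and> (\<forall>i. 0 \<le> b i) \<and>
        (\<forall>S\<subseteq>{0..<n}. q (f t) S t = (c::real) * (\<Prod>i\<in>{0..<n}. if i \<in> S then b i else a i))"
      unfolding q_def by (rule pmf_run_product) (use \<pi> in \<open>unfold valid_protocol_def, blast\<close>)
    then obtain c :: real and a b where ab: "0 \<le> c" "\<forall>i. 0 \<le> a i" "\<forall>i. 0 \<le> b i"
      "\<forall>S\<subseteq>{0..<n}. q (f t) S t = c * (\<Prod>i\<in>{0..<n}. if i \<in> S then b i else a i)"
      by (elim exE conjE) (erule (3) that)
    show ?thesis
    proof (rule product_family_bound[where a=a and b=b, OF finite_atLeastLessThan _ ab(1) ab(2)[rule_format] ab(3)[rule_format] M])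
      show "{0..<n} \<noteq> {}" using assms(1) by simp
    qed (use ab(4) in blast)
  qed
  then have "\<forall>t. \<exists>i. i < n \<and> (\<Sum>S | S \<in> Sub l \<and> i \<notin> S. q (f t) S t) \<le>
    M ^ l / fact l * q (f t) {} t + real (Suc l) / M * (\<Sum>S\<in>Sub (Suc l). q (f t) S t)"
    unfolding Sub_def mem_Collect_eq conj_assoc Bex_def atLeastLessThan_iff by fast
  from choice[OF this] obtain e where e: "\<And>t. e t < n"
    and e_le: "\<And>t. (\<Sum>S | S \<in> Sub l \<and> e t \<notin> S. q (f t) S t) \<le>
      M ^ l / fact l * q (f t) {} t + real (Suc l) / M * (\<Sum>S\<in>Sub (Suc l). q (f t) S t)"
    by (elim exE) (rule that, blast+)
  \<comment> \<open>A finite set carrying all relevant transcripts, which turns probabilities into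
    finite sums.\<close>
  define T where "T = (\<Union>x\<in>{0..N}. \<Union>S\<in>Pow {0..<n}. set_pmf (transcript \<pi> x S))"
  have fin_T: "finite T" unfolding T_def by (intro finite_UN_I) (auto intro: finite_set_run[OF \<pi>])
  define Z where "Z = real N * real (n choose l)"
  have Z: "0 < Z" using assms by (simp add: Z_def)
  have q_nonneg: "0 \<le> q x S t" for x S t by (simp add: q_def)
  have sum_q: "(\<Sum>t\<in>T. q x S t) \<le> 1" for x S unfolding q_def by (rule sum_pmf_le_1[OF fin_T])
  have swap: "(\<Sum>x\<in>{1..N}. \<Sum>S\<in>Sub k. \<Sum>t\<in>T. F x S t) =
      (\<Sum>t\<in>T. \<Sum>x\<in>{1..N}. \<Sum>S\<in>Sub k. F x S t)" for k and F :: "nat \<Rightarrow> nat set \<Rightarrow> nat list \<Rightarrow> real"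
    unfolding sum.swap[of _ T] by (rule refl)
  have "Z * payoff n N (uniform_weight N l n) \<pi> f (\<lambda>t _. e t) =
      (\<Sum>x\<in>{1..N}. \<Sum>S\<in>Pow {0..<n}. of_bool (card S = l) * (\<Sum>t\<in>T. of_bool (f t = x \<and> e t \<notin> S) * q x S t))"
    unfolding payoff_def sum_distrib_left
  proof (intro sum.cong refl)
    fix x S assume "x \<in> {1..N}" "S \<in> Pow {0..<n}"
    then have "measure_pmf.prob (transcript \<pi> x S) {t. f t = x \<and> e t \<notin> S} =
        (\<Sum>t\<in>T. of_bool (f t = x \<and> e t \<notin> S) * q x S t)"
      unfolding q_def by (subst prob_eq_sum[OF fin_T]) (auto simp: T_def intro!: bexI[of _ x])
    moreover have "Z * uniform_weight N l n S = of_bool (card S = l)"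
      using Z unfolding uniform_weight_def Z_def[symmetric] by simp
    ultimately show "Z * (uniform_weight N l n S * measure_pmf.prob (transcript \<pi> x S) {t. f t = x \<and> e t \<notin> S}) =
        (\<Sum>t\<in>T. of_bool (card S = l) * (of_bool (f t = x \<and> e t \<notin> S) * q x S t))"
      by (simp only: sum_distrib_left flip: mult.assoc)
  qed
  also have "\<dots> = (\<Sum>x\<in>{1..N}. \<Sum>S\<in>Sub l. \<Sum>t\<in>T. of_bool (f t = x \<and> e t \<notin> S) * q x S t)"
  proof (rule sum.cong[OF refl])
    fix x
    have "(\<Sum>S\<in>Pow {0..<n}. of_bool (card S = l) * (\<Sum>t\<in>T. of_bool (f t = x \<and> e t \<notin> S) * q x S t)) =
        (\<Sum>S\<in>Pow {0..<n} \<inter> {S. card S = l}. \<Sum>t\<in>T. of_bool (f t = x \<and> e t \<notin> S) * q x S t)"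
      by (subst sum.inter_restrict) (auto simp: of_bool_def intro!: sum.cong)
    also have "Pow {0..<n} \<inter> {S. card S = l} = Sub l" by (auto simp: Sub_def)
    finally show "(\<Sum>S\<in>Pow {0..<n}. of_bool (card S = l) * (\<Sum>t\<in>T. of_bool (f t = x \<and> e t \<notin> S) * q x S t)) =
        (\<Sum>S\<in>Sub l. \<Sum>t\<in>T. of_bool (f t = x \<and> e t \<notin> S) * q x S t)" .
  qed
  also have "\<dots> = (\<Sum>t\<in>T. \<Sum>x\<in>{1..N}. \<Sum>S\<in>Sub l. of_bool (f t = x \<and> e t \<notin> S) * q x S t)"
    by (rule swap)
  also have "\<dots> \<le> (\<Sum>t\<in>T. M ^ l / fact l * q 0 {} t +
      real (Suc l) / M * (\<Sum>x\<in>{1..N}. \<Sum>S\<in>Sub (Suc l). q x S t))"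
  proof (rule sum_mono)
    fix t
    have first: "0 \<le> M ^ l / fact l * q 0 {} t" using M q_nonneg by simp
    have second: "0 \<le> (\<Sum>S\<in>Sub (Suc l). q x S t)" for x by (intro sum_nonneg q_nonneg)
    \<comment> \<open>Secret 0 is a placeholder: putting it for \<open>f t\<close> yields one fixed
      distribution, whose sum over \<open>t\<close> is at most 1.\<close>
    have q0: "q 0 {} t = q (f t) {} t" unfolding q_def by (subst run_no_leaker) (rule refl)
    show "(\<Sum>x\<in>{1..N}. \<Sum>S\<in>Sub l. of_bool (f t = x \<and> e t \<notin> S) * q x S t) \<le>
        M ^ l / fact l * q 0 {} t + real (Suc l) / M * (\<Sum>x\<in>{1..N}. \<Sum>S\<in>Sub (Suc l). q x S t)"
    proof (cases "f t \<in> {1..N}")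
      case True
      have "(\<Sum>x\<in>{1..N}. \<Sum>S\<in>Sub l. of_bool (f t = x \<and> e t \<notin> S) * q x S t) =
          (\<Sum>x\<in>{1..N}. if f t = x then \<Sum>S\<in>Sub l. of_bool (e t \<notin> S) * q x S t else 0)"
        by (intro sum.cong) auto
      also have "\<dots> = (\<Sum>S\<in>Sub l. of_bool (e t \<notin> S) * q (f t) S t)"
        using True by simp
      also have "\<dots> = (\<Sum>S\<in>Sub l \<inter> {S. e t \<notin> S}. q (f t) S t)"
        by (subst sum.inter_restrict[OF fin_Sub]) (auto intro!: sum.cong)
      also have "\<dots> = (\<Sum>S | S \<in> Sub l \<and> e t \<notin> S. q (f t) S t)"
        by (intro sum.cong) auto
      also have "\<dots> \<le> M ^ l / fact l * q (f t) {} t + real (Suc l) / M * (\<Sum>S\<in>Sub (Suc l). q (f t) S t)"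
        by (rule e_le)
      \<comment> \<open>The single secret \<open>f t\<close> is enlarged to all secrets, so that the
        sum over transcripts can be taken inside.\<close>
      also have "\<dots> \<le> M ^ l / fact l * q 0 {} t +
          real (Suc l) / M * (\<Sum>x\<in>{1..N}. \<Sum>S\<in>Sub (Suc l). q x S t)"
        unfolding q0 using M True second
        by (intro add_left_mono mult_left_mono member_le_sum) auto
      finally show ?thesis .
    next
      case False
      then have "(\<Sum>x\<in>{1..N}. \<Sum>S\<in>Sub l. of_bool (f t = x \<and> e t \<notin> S) * q x S t) = 0"
        by (intro sum.neutral ballI) auto
      then show ?thesis
        using first M second by (simp add: sum_nonneg del: of_nat_Suc)
    qed
  qed
  also have "\<dots> = M ^ l / fact l * (\<Sum>t\<in>T. q 0 {} t) +
      real (Suc l) / M * (\<Sum>x\<in>{1..N}. \<Sum>S\<in>Sub (Suc l). \<Sum>t\<in>T. q x S t)"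
    unfolding swap sum.distrib sum_distrib_left[symmetric] by (rule refl)
  also have "\<dots> \<le> M ^ l / fact l * 1 + real (Suc l) / M * (\<Sum>x\<in>{1..N}. \<Sum>S\<in>Sub (Suc l). 1)"
    using M by (intro add_mono mult_left_mono sum_mono sum_q) auto
  also have "\<dots> = M ^ l / fact l + real N * real (Suc l * (n choose Suc l)) / M"
    by (simp add: card_Sub mult_ac del: binomial_Suc_Suc of_nat_Suc mult_Suc mult_Suc_right)
  also have "Suc l * (n choose Suc l) = (n - l) * (n choose l)"
    using binomial_absorption[of l n] binomial_absorb_comp[of n l] by simp
  also have "M ^ l / fact l + real N * real ((n - l) * (n choose l)) / M \<le> M ^ l / fact l + Z * real n / M"
  proof -
    have "real N * real ((n - l) * (n choose l)) \<le> real N * real (n * (n choose l))"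
      by (intro mult_left_mono of_nat_mono mult_right_mono) auto
    then show ?thesis using M by (simp add: Z_def mult_ac divide_right_mono)
  qed
  finally have "Z * payoff n N (uniform_weight N l n) \<pi> f (\<lambda>t _. e t) \<le> M ^ l / fact l + Z * real n / M" .
  then have "payoff n N (uniform_weight N l n) \<pi> f (\<lambda>t _. e t) \<le> (M ^ l / fact l + Z * real n / M) / Z"
    using Z by (simp add: pos_le_divide_eq mult.commute)
  also have "\<dots> = real n ^ l / (fact l * real (n choose l)) * (\<tau> ^ l / real N) + 1 / \<tau>"
    using assms Z by (simp add: add_divide_distrib M_def power_mult_distrib Z_def mult_ac)
  finally show "\<exists>g\<in>guesses n. payoff n N (uniform_weight N l n) \<pi> f g \<le>
      real n ^ l / (fact l * real (n choose l)) * (\<tau> ^ l / real N) + 1 / \<tau>"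
    using e by blast
qed (rule uniform_weight_nonneg)

section \<open>Return to \<open>Succ\<close> and existence of its limit\<close>

lemma Succ_n_eq_opt_value:
  assumes "l \<le> n"
  shows "Succ_n h l n = opt_value n (2 ^ nat \<lceil>h\<rceil>) (uniform_weight (2 ^ nat \<lceil>h\<rceil>) l n)"
proof -
  define N :: nat where "N = 2 ^ nat \<lceil>h\<rceil>"
  let ?Sub = "{S. S \<subseteq> {0..<n} \<and> card S = l}"
  have card_Sub: "card ?Sub = n choose l" by (simp add: n_subsets)
  then have Sub: "?Sub \<noteq> {}" using assms by (metis binomial_eq_0_iff card.empty not_less)
  have "win_prob h l n \<pi> f g = payoff n N (uniform_weight N l n) \<pi> f g" for \<pi> f g
  proof -
    define P where "P x S = measure_pmf.prob (transcript \<pi> x S) {t. f t = x \<and> g t (f t) \<notin> S}" for x S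
    have "win_prob h l n \<pi> f g = (\<Sum>x\<in>{1..N}. (\<Sum>S\<in>?Sub. P x S) / (n choose l)) / N"
      unfolding win_prob_def game_def N_def[symmetric]
      using Sub by (simp add: prob_bind_pmf integral_pmf_of_set card_Sub N_def P_def vimage_def sum_divide_distrib mult.commute)
    also have "\<dots> = (\<Sum>x\<in>{1..N}. \<Sum>S\<in>?Sub. uniform_weight N l n S * P x S)"
      unfolding sum_divide_distrib by (intro sum.cong) (auto simp: uniform_weight_def mult_ac)
    also have "\<dots> = payoff n N (uniform_weight N l n) \<pi> f g"
      unfolding payoff_def P_def[symmetric]
      by (intro sum.cong refl sum.mono_neutral_left) (auto simp: uniform_weight_def)
    finally show ?thesis .
  qed
  then show ?thesis by (simp add: Succ_n_def Succ_prot_def opt_value_def N_def)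
qed

text \<open>The denominator is a falling factorial: \<open>l\<close> factors \<open>n - i\<close>,
  each asymptotic to \<open>n\<close>.\<close>

lemma power_over_falling_tendsto:
  "(\<lambda>n. real n ^ l / (fact l * real (n choose l))) \<longlonglongrightarrow> 1"
proof -
  have "(\<lambda>n. \<Prod>i\<in>{0..<l}. (real n - real i) / real n) \<longlonglongrightarrow> (\<Prod>i\<in>{0..<l}. 1)"
    by (intro tendsto_prod) real_asymp
  then have "(\<lambda>n. inverse (\<Prod>i\<in>{0..<l}. (real n - real i) / real n)) \<longlonglongrightarrow> inverse 1"
    by (intro tendsto_inverse) auto
  also have "(\<lambda>n. inverse (\<Prod>i\<in>{0..<l}. (real n - real i) / real n)) =
      (\<lambda>n. real n ^ l / (fact l * real (n choose l)))"
    by (simp add: binomial_gbinomial gbinomial_prod_rev prod_dividef)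
  finally show ?thesis by simp
qed

lemma Succ_nonneg_le:
  assumes "0 < \<tau>"
  shows "0 \<le> Succ h l" and "Succ h l \<le> \<tau> ^ l / 2 ^ nat \<lceil>h\<rceil> + 1 / \<tau>"
proof -
  define N :: nat where "N = 2 ^ nat \<lceil>h\<rceil>"
  \<comment> \<open>The shift by \<open>Suc l\<close> keeps the number of players above
    \<open>l\<close> throughout.\<close>
  define X where "X n = Succ_n h l (n + Suc l)" for n
  define b where "b \<tau> n = real (n + Suc l) ^ l / (fact l * real (n + Suc l choose l)) * (\<tau> ^ l / real N) + 1 / \<tau>"
    for \<tau> n
  have X_eq: "X n = opt_value (n + Suc l) N (uniform_weight N l (n + Suc l))" for n
    by (simp add: X_def N_def Succ_n_eq_opt_value)
  have X_le: "X n \<le> b \<tau> n" if "0 < \<tau>" for n \<tau>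
    unfolding X_eq b_def using that by (intro opt_value_uniform_le) (auto simp: N_def)
  have X_nonneg: "0 \<le> X n" for n
    unfolding X_eq by (intro opt_value_nonneg uniform_weight_nonneg) auto
  have "b \<tau> \<longlonglongrightarrow> 1 * (\<tau> ^ l / real N) + 1 / \<tau>" for \<tau>
    unfolding b_def by (intro tendsto_intros LIMSEQ_ignore_initial_segment[OF power_over_falling_tendsto])
  then have b: "b \<tau> \<longlonglongrightarrow> \<tau> ^ l / real N + 1 / \<tau>" for \<tau> by simp
  have "incseq X"
    unfolding X_eq by (intro incseq_SucI) (simp add: opt_value_uniform_Suc)
  \<comment> \<open>The upper bound with \<tau> = 1 converges and is therefore bounded; with
    monotonicity this gives the limit that \<open>lim\<close> presupposes.\<close>
  moreover obtain B where "X n \<le> B" for n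
  proof -
    have "Bseq (b 1)" using b[of 1] by (auto intro: convergent_imp_Bseq convergentI)
    then obtain B where "norm (b 1 n) \<le> B" for n by (auto simp: Bseq_def)
    then have "X n \<le> B" for n using X_le[of 1 n] by (smt (verit) real_norm_def)
    then show thesis by (rule that)
  qed
  ultimately obtain L where L: "X \<longlonglongrightarrow> L" by (meson incseq_convergent)
  then have "Succ_n h l \<longlonglongrightarrow> L"
    unfolding X_def by (rule LIMSEQ_offset)
  then have L_eq: "Succ h l = L" unfolding Succ_def by (rule limI)
  show "0 \<le> Succ h l"
    unfolding L_eq using L X_nonneg by (intro LIMSEQ_le_const) auto
  show "Succ h l \<le> \<tau> ^ l / 2 ^ nat \<lceil>h\<rceil> + 1 / \<tau>"
    using LIMSEQ_le[OF L b[of \<tau>]] X_le[OF assms] by (auto simp: L_eq N_def)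
qed

section \<open>Asymptotics of the bound\<close>

lemma powr_le_two_power_nat_ceiling: "2 powr h \<le> 2 ^ nat \<lceil>h\<rceil>" for h :: real
proof -
  have "h \<le> real (nat \<lceil>h\<rceil>)" by linarith
  then have "2 powr h \<le> 2 powr real (nat \<lceil>h\<rceil>)" by simp
  then show ?thesis by (simp add: powr_realpow)
qed

lemma limsup_Succ_le:
  assumes "0 < r"
  shows "limsup (\<lambda>l. ereal (Succ (real_of_int \<lceil>r * log 2 (exp 1) * real l\<rceil>) l))
    \<le> ereal (log 2 (r + 1) / (r * log 2 (exp 1)))"
proof -
  have "1 + r < (1 + r / 2)\<^sup>2" using assms by (simp add: power2_eq_square algebra_simps)
  also have "\<dots> \<le> exp (r / 2) ^ 2" using assms by (intro power_mono exp_ge_add_one_self) auto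
  also have "\<dots> = exp r" by (simp flip: exp_double)
  finally have exp_r: "1 + r < exp r" .
  \<comment> \<open>With \<tau> = 1 + r and at least \<open>exp r ^ l\<close> secrets, the guessing
    term is at most \<open>q ^ l\<close> and vanishes.\<close>
  define q where "q = (1 + r) / exp r"
  have q: "0 \<le> q" "q < 1" using exp_r assms by (auto simp: q_def)
  have Succ_le: "Succ (real_of_int \<lceil>r * log 2 (exp 1) * real l\<rceil>) l \<le> q ^ l + 1 / (1 + r)" for l
  proof -
    let ?h = "r * log 2 (exp 1) * real l"
    have "exp r ^ l = 2 powr ?h"
      by (simp add: powr_def log_def exp_of_nat_mult[symmetric] mult.commute)
    also have "\<dots> \<le> 2 powr real_of_int \<lceil>?h\<rceil>" by simp
    also have "\<dots> \<le> 2 ^ nat \<lceil>real_of_int \<lceil>?h\<rceil>\<rceil>" by (rule powr_le_two_power_nat_ceiling)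
    finally have "(1 + r) ^ l / 2 ^ nat \<lceil>real_of_int \<lceil>?h\<rceil>\<rceil> \<le> (1 + r) ^ l / exp r ^ l"
      using assms by (intro divide_left_mono) auto
    also have "\<dots> = q ^ l" by (simp add: q_def power_divide)
    finally show ?thesis using Succ_nonneg_le(2)[of "1 + r" "real_of_int \<lceil>?h\<rceil>" l] assms by simp
  qed
  have "(\<lambda>l. q ^ l + 1 / (1 + r)) \<longlonglongrightarrow> 0 + 1 / (1 + r)"
    using q by (intro tendsto_intros LIMSEQ_realpow_zero)
  then have limsup_q: "limsup (\<lambda>l. ereal (q ^ l + 1 / (1 + r))) = ereal (1 / (1 + r))"
    by (intro lim_imp_Limsup) auto
  have "limsup (\<lambda>l. ereal (Succ (real_of_int \<lceil>r * log 2 (exp 1) * real l\<rceil>) l)) \<le>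
      limsup (\<lambda>l. ereal (q ^ l + 1 / (1 + r)))"
    using Succ_le by (intro Limsup_mono) auto
  also note limsup_q
  \<comment> \<open>The limit \<open>1 / (1 + r)\<close> lies below the claimed bound, by
    \<open>ln y \<le> y - 1\<close> at \<open>y = 1 / (1 + r)\<close>.\<close>
  also have "ereal (1 / (1 + r)) \<le> ereal (ln (1 + r) / r)"
  proof -
    have "ln (inverse (1 + r)) \<le> inverse (1 + r) - 1" using assms by (intro ln_le_minus_one) auto
    then have "1 - inverse (1 + r) \<le> ln (1 + r)" using assms by (simp add: ln_inverse)
    moreover have "1 - inverse (1 + r) = r / (1 + r)" using assms by (simp add: field_simps)
    ultimately show ?thesis using assms by (simp add: field_simps)
  qed
  also have "ln (1 + r) / r = log 2 (r + 1) / (r * log 2 (exp 1))"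
    by (simp add: log_def add.commute)
  finally show ?thesis by simp
qed

lemma Succ_tendsto_0:
  assumes "(\<lambda>h. real (L h)) \<in> o[at_top](\<lambda>h. h)"
  shows "((\<lambda>h. Succ h (L h)) \<longlongrightarrow> 0) at_top"
proof (rule tendstoI)
  fix \<epsilon> :: real assume \<epsilon>: "0 < \<epsilon>"
  \<comment> \<open>For \<tau> = \<open>2 powr k\<close> the term \<open>1 / \<tau>\<close> is at
    most \<open>\<epsilon> / 2\<close>. Once \<open>L h \<le> h / (2 * k)\<close>, the other term is
    at most \<open>2 powr (- h / 2)\<close>.\<close>
  define k where "k = max 1 (log 2 (2 / \<epsilon>))"
  have k: "1 \<le> k" by (simp add: k_def)
  have "2 / \<epsilon> = 2 powr (log 2 (2 / \<epsilon>))" using \<epsilon> by simp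
  also have "\<dots> \<le> 2 powr k" by (simp add: k_def)
  finally have inv: "1 / 2 powr k \<le> \<epsilon> / 2" using \<epsilon> by (simp add: field_simps)
  have "\<forall>\<^sub>F h in at_top. norm (real (L h)) \<le> 1 / (2 * k) * norm h"
    using k by (intro landau_o.smallD[OF assms]) auto
  moreover have "((\<lambda>h::real. 2 powr (- h / 2)) \<longlongrightarrow> 0) at_top" by real_asymp
  then have "\<forall>\<^sub>F h::real in at_top. 2 powr (- h / 2) < \<epsilon> / 2"
    using \<epsilon> by (intro order_tendstoD) auto
  ultimately show "\<forall>\<^sub>F h in at_top. dist (Succ h (L h)) 0 < \<epsilon>"
    using eventually_gt_at_top[of 0]
  proof eventually_elim
    case (elim h)
    have "k * real (L h) \<le> h / 2" using elim(1,3) k by (simp add: field_simps)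
    then have "2 powr (k * real (L h) - h) \<le> 2 powr (- h / 2)" by simp
    then have "(2 powr k) ^ L h / 2 powr h \<le> 2 powr (- h / 2)"
      by (simp add: powr_power powr_diff mult.commute)
    moreover have "(2 powr k) ^ L h / 2 ^ nat \<lceil>h\<rceil> \<le> (2 powr k) ^ L h / 2 powr h"
      by (intro divide_left_mono powr_le_two_power_nat_ceiling) auto
    moreover have "Succ h (L h) \<le> (2 powr k) ^ L h / 2 ^ nat \<lceil>h\<rceil> + 1 / 2 powr k"
      by (rule Succ_nonneg_le(2)) simp
    moreover have "0 \<le> Succ h (L h)" by (rule Succ_nonneg_le(1)[of 1]) simp
    ultimately show ?case using elim(2) inv by simp
  qed
qed

theorem theorem5p10:
  shows "(\<forall>r::real. r > 0 \<longrightarrow>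
           limsup (\<lambda>l::nat. ereal (Succ (real_of_int \<lceil>r * log 2 (exp 1) * real l\<rceil>) l))
             \<le> ereal (log 2 (r + 1) / (r * log 2 (exp 1))))
       \<and> (\<forall>L :: real \<Rightarrow> nat. (\<forall>h. 1 \<le> L h) \<longrightarrow>
           (\<lambda>h. real (L h)) \<in> o[at_top](\<lambda>h. h) \<longrightarrow>
           ((\<lambda>h. Succ h (L h)) \<longlongrightarrow> 0) at_top)"
  using limsup_Succ_le Succ_tendsto_0 by blast

end
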